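(* Let $\mathcal{H}_1,\mathcal{H}_2,\mathcal{H}$ be finite-dimensional complex Hilbert spaces. Suppose $\otimes,\otimes':\mathcal{H}_1\times\mathcal{H}_2\to\mathcal{H}$ are tensor product operators with $\otimes'=W\circ\otimes$, where $W$ is a unitary operator on $\mathcal{H}$. Let $L$ be a linear operator on $\mathcal{H}$, and let $L_1$ and $L_2$ be linear operators on $\mathcal{H}_1$ and $\mathcal{H}_2$, respectively. Then $$W^\dagger L W=L_1\otimes L_2\quad\text{if and only if}\quad L=L_1\otimes' L_2,$$ and for any vector $x\in\mathcal{H}$, $$(WLW^\dagger)\,Wx=WLx.$$
   Context: All Hilbert spaces are complex and finite-dimensional. A tensor product operator $\otimes:\mathcal{H}_1\times\mathcal{H}_2\to\mathcal{H}$ is a bilinear map such that: (i) (maximal generality) for every Hilbert space $\mathcal{V}'$ and every bilinear map $\beta:\mathcal{H}_1\times\mathcal{H}_2\to\mathcal{V}'$ there is a unique linear map $L:\mathcal{H}\to\mathcal{V}'$ with $\beta(x,y)=L(x\otimes y)$ for all $(x,y)\in\mathcal{H}_1\times\mathcal{H}_2$; (ii) (norm preservation) if $\|x\|=\|y\|=1$ then $\|x\otimes y\|=1$. There may be many different tensor product operators with the same $\mathcal{H}_1,\mathcal{H}_2,\mathcal{H}$. For a tensor product operator $\otimes$ and linear operators $L_1$ on $\mathcal{H}_1$ and $L_2$ on $\mathcal{H}_2$, $L_1\otimes L_2$ denotes the unique linear operator on $\mathcal{H}$ satisfying $(L_1\otimes L_2)(x\otimes y)=(L_1x)\otimes(L_2y)$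 for all $x\in\mathcal{H}_1$, $y\in\mathcal{H}_2$; $L_1\otimes' L_2$ is defined in the same way from $\otimes'$. The relation $\otimes'=W\circ\otimes$ means $x\otimes' y=W(x\otimes y)$ for all $(x,y)\in\mathcal{H}_1\times\mathcal{H}_2$. $W^\dagger$ denotes the adjoint of $W$. *)

theory Defs
  imports Complex_Main "HOL-Library.FuncSet" "HOL-Algebra.Algebraic_Closure_Type"
begin

text \<open>
  A Hilbert space is a module over the ring of complex numbers together with an inner product.
  The fields \<open>mult\<close> and \<open>one\<close>, inherited from the record of modules, play no role. Linear and
  bilinear maps only matter on carriers; linear operators are made extensional (undefined outside
  the carrier), so that equality of operators is equality of functions and \<open>compose (carrier H)\<close>
  is the product of operators.
\<close>

abbreviation complex_ring :: "complex ring"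
  where "complex_ring \<equiv> ring_of_type_algebra"

record 'v hilbert = "(complex, 'v) module" +
  cinner :: "'v \<Rightarrow> 'v \<Rightarrow> complex"

text \<open>
  The inner product is linear in the second argument. No completeness axiom is needed, because of
  finite dimension.
\<close>

locale fd_hilbert = module complex_ring H for H :: "'v hilbert" (structure) +
  assumes cinner_add_right:
      "\<lbrakk>x \<in> carrier H; y \<in> carrier H; z \<in> carrier H\<rbrakk>
        \<Longrightarrow> cinner H x (y \<oplus> z) = cinner H x y + cinner H x z"
    and cinner_smult_right:
      "\<lbrakk>x \<in> carrier H; y \<in> carrier H\<rbrakk> \<Longrightarrow> cinner H x (a \<odot> y) = a * cinner H x y"
    and cinner_commute:
      "\<lbrakk>x \<in> carrier H; y \<in> carrier H\<rbrakk> \<Longrightarrow> cinner H x y = cnj (cinner H y x)"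
    and cinner_nonneg: "x \<in> carrier H \<Longrightarrow> 0 \<le> Re (cinner H x x)"
    and cinner_definite: "\<lbrakk>x \<in> carrier H; cinner H x x = 0\<rbrakk> \<Longrightarrow> x = \<zero>"
    and finite_dim:
      "\<exists>B. finite B \<and> B \<subseteq> carrier H \<and>
        (\<forall>x\<in>carrier H. \<exists>c. x = (\<Oplus>b\<in>B. c b \<odot> b))"

definition hnorm :: "'v hilbert \<Rightarrow> 'v \<Rightarrow> real"
  where "hnorm H x = sqrt (Re (cinner H x x))"

definition linear_map :: "'v hilbert \<Rightarrow> 'w hilbert \<Rightarrow> ('v \<Rightarrow> 'w) \<Rightarrow> bool"
  where "linear_map H K f \<longleftrightarrow>
    f \<in> carrier H \<rightarrow> carrier K \<and>
    (\<forall>x\<in>carrier H. \<forall>y\<in>carrier H. f (x \<oplus>\<^bsub>H\<^esub> y) = f x \<oplus>\<^bsub>K\<^esub> f y) \<and>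
    (\<forall>a. \<forall>x\<in>carrier H. f (a \<odot>\<^bsub>H\<^esub> x) = a \<odot>\<^bsub>K\<^esub> f x)"

definition lin_maps :: "'v hilbert \<Rightarrow> 'w hilbert \<Rightarrow> ('v \<Rightarrow> 'w) set"
  where "lin_maps H K = {f \<in> extensional (carrier H). linear_map H K f}"

abbreviation lin_ops :: "'v hilbert \<Rightarrow> ('v \<Rightarrow> 'v) set"
  where "lin_ops H \<equiv> lin_maps H H"

definition id_op :: "'v hilbert \<Rightarrow> 'v \<Rightarrow> 'v"
  where "id_op H = (\<lambda>x\<in>carrier H. x)"

definition bilinear_map ::
    "'a hilbert \<Rightarrow> 'b hilbert \<Rightarrow> 'v hilbert \<Rightarrow> ('a \<Rightarrow> 'b \<Rightarrow> 'v) \<Rightarrow> bool"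
  where "bilinear_map H1 H2 V \<beta> \<longleftrightarrow>
    (\<forall>y\<in>carrier H2. linear_map H1 V (\<lambda>x. \<beta> x y)) \<and>
    (\<forall>x\<in>carrier H1. linear_map H2 V (\<lambda>y. \<beta> x y))"

definition is_adjoint :: "'v hilbert \<Rightarrow> ('v \<Rightarrow> 'v) \<Rightarrow> ('v \<Rightarrow> 'v) \<Rightarrow> bool"
  where "is_adjoint H A B \<longleftrightarrow> B \<in> lin_ops H \<and>
    (\<forall>x\<in>carrier H. \<forall>y\<in>carrier H. cinner H (B x) y = cinner H x (A y))"

definition adj :: "'v hilbert \<Rightarrow> ('v \<Rightarrow> 'v) \<Rightarrow> 'v \<Rightarrow> 'v"
  where "adj H A = (THE B. is_adjoint H A B)"

text \<open>
  The operator \<open>B\<close> below is the adjoint of \<open>W\<close>, by \<open>adj_eqI\<close> proved afterwards.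
\<close>

definition unitary_op :: "'v hilbert \<Rightarrow> ('v \<Rightarrow> 'v) \<Rightarrow> bool"
  where "unitary_op H W \<longleftrightarrow> W \<in> lin_ops H \<and>
    (\<exists>B. is_adjoint H W B \<and>
      compose (carrier H) B W = id_op H \<and> compose (carrier H) W B = id_op H)"

text \<open>
  Maximal generality quantifies over all finite-dimensional Hilbert spaces \<open>V\<close>, which a definition
  can do only within one type. The type \<open>nat \<Rightarrow> complex\<close> is large enough to contain an isomorphic
  copy of each of them; the lemma \<open>tensor_product_universal\<close> below gives the property for \<open>V\<close> over
  an arbitrary type.
\<close>

definition tensor_product ::
    "'a hilbert \<Rightarrow> 'b hilbert \<Rightarrow> 'c hilbert \<Rightarrow> ('a \<Rightarrow> 'b \<Rightarrow> 'c) \<Rightarrow> bool"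
  where "tensor_product H1 H2 H T \<longleftrightarrow>
    bilinear_map H1 H2 H T \<and>
    (\<forall>V :: (nat \<Rightarrow> complex) hilbert. fd_hilbert V \<longrightarrow>
      (\<forall>\<beta>. bilinear_map H1 H2 V \<beta> \<longrightarrow>
        (\<exists>!L. L \<in> lin_maps H V \<and>
          (\<forall>x\<in>carrier H1. \<forall>y\<in>carrier H2. \<beta> x y = L (T x y))))) \<and>
    (\<forall>x\<in>carrier H1. \<forall>y\<in>carrier H2.
      hnorm H1 x = 1 \<longrightarrow> hnorm H2 y = 1 \<longrightarrow> hnorm H (T x y) = 1)"

definition tensor_op ::
    "'a hilbert \<Rightarrow> 'b hilbert \<Rightarrow> 'c hilbert \<Rightarrow> ('a \<Rightarrow> 'b \<Rightarrow> 'c)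
      \<Rightarrow> ('a \<Rightarrow> 'a) \<Rightarrow> ('b \<Rightarrow> 'b) \<Rightarrow> 'c \<Rightarrow> 'c"
  where "tensor_op H1 H2 H T L1 L2 =
    (THE M. M \<in> lin_ops H \<and>
      (\<forall>x\<in>carrier H1. \<forall>y\<in>carrier H2. M (T x y) = T (L1 x) (L2 y)))"

lemma (in fd_hilbert) cinner_left_eqI:
  assumes u: "u \<in> carrier H" and v: "v \<in> carrier H"
    and eq: "\<And>y. y \<in> carrier H \<Longrightarrow> cinner H u y = cinner H v y"
  shows "u = v"
proof -
  have m1: "(-1) \<odot> v \<in> carrier H"
    using v by (intro smult_closed) (auto simp: ring_of_type_algebra_def)
  define w where "w = u \<oplus> (-1) \<odot> v"
  have w: "w \<in> carrier H" using u m1 by (simp add: w_def)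
  have "cinner H w u = cinner H w v"
    using eq[OF w] cinner_commute[OF w u] cinner_commute[OF w v] by simp
  then have "cinner H w w = 0"
    unfolding w_def
    using cinner_add_right[OF w u m1] cinner_smult_right[OF w v, of "-1"] w_def by simp
  then have "w = \<zero>" using cinner_definite w by blast
  have v2: "(-1) \<odot> v \<oplus> v = \<zero>"
  proof -
    have "(-1) \<odot> v \<oplus> 1 \<odot> v = ((-1) \<oplus>\<^bsub>complex_ring\<^esub> 1) \<odot> v"
      using smult_l_distr[of "-1" 1 v] v by (auto simp: ring_of_type_algebra_def)
    also have "\<dots> = \<zero>"
      using smult_l_null[OF v] by (simp add: ring_of_type_algebra_def)
    finally show ?thesis
      using smult_one[OF v] by (simp add: ring_of_type_algebra_def)
  qed
  have "u = u \<oplus> ((-1) \<odot> v \<oplus> v)" using u v2 by simp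
  also have "\<dots> = w \<oplus> v" unfolding w_def using u v m1 by (simp add: M.a_assoc)
  also have "\<dots> = v" using \<open>w = \<zero>\<close> v by simp
  finally show ?thesis .
qed

lemma adj_eqI:
  assumes "fd_hilbert H" "is_adjoint H A B"
  shows "adj H A = B"
proof -
  interpret fd_hilbert H by fact
  have "C = B" if C: "is_adjoint H A C" for C
  proof (rule extensionalityI[of _ "carrier H"])
    show "C \<in> extensional (carrier H)" "B \<in> extensional (carrier H)"
      using C assms(2) by (auto simp: is_adjoint_def lin_maps_def)
    fix x assume "x \<in> carrier H"
    then show "C x = B x"
      using C assms(2)
      by (intro cinner_left_eqI) (auto simp: is_adjoint_def lin_maps_def linear_map_def)
  qed
  then show ?thesis unfolding adj_def using assms(2) by blast
qed

lemma fd_hilbert_copy: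
  fixes V :: "'v hilbert"
  assumes "fd_hilbert V"
  obtains V' :: "(nat \<Rightarrow> complex) hilbert" and f
  where "fd_hilbert V'" "linear_map V V' f" "bij_betw f (carrier V) (carrier V')"
proof -
  interpret V: fd_hilbert V by fact
  obtain B where B: "finite B" "B \<subseteq> carrier V"
    and span: "\<And>x. x \<in> carrier V \<Longrightarrow> \<exists>c. x = (\<Oplus>\<^bsub>V\<^esub>b\<in>B. c b \<odot>\<^bsub>V\<^esub> b)"
    using V.finite_dim by blast
  obtain e :: "'v \<Rightarrow> nat" where e: "inj_on e B"
    using finite_imp_inj_to_nat_seg[OF B(1)] by blast
  define c where "c x = (SOME c. x = (\<Oplus>\<^bsub>V\<^esub>b\<in>B. c b \<odot>\<^bsub>V\<^esub> b))" for x
  have c: "x = (\<Oplus>\<^bsub>V\<^esub>b\<in>B. c x b \<odot>\<^bsub>V\<^esub> b)" if "x \<in> carrier V" for x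
    unfolding c_def by (rule someI_ex[OF span[OF that]])
  define f :: "'v \<Rightarrow> nat \<Rightarrow> complex"
    where "f x = (\<lambda>i. c x (inv_into B e i))" for x
  have smc: "a \<odot>\<^bsub>V\<^esub> x \<in> carrier V" if "x \<in> carrier V" for a x
    using that by (intro V.smult_closed) (auto simp: ring_of_type_algebra_def)
  have inj: "inj_on f (carrier V)"
  proof (rule inj_onI)
    fix x y assume xy: "x \<in> carrier V" "y \<in> carrier V" "f x = f y"
    have "c x b = c y b" if "b \<in> B" for b
      using fun_cong[OF xy(3), of "e b"] that e by (simp add: f_def)
    then have "(\<Oplus>\<^bsub>V\<^esub>b\<in>B. c x b \<odot>\<^bsub>V\<^esub> b) = (\<Oplus>\<^bsub>V\<^esub>b\<in>B. c y b \<odot>\<^bsub>V\<^esub> b)"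
      using B smc by (intro V.M.finsum_cong') auto
    then show "x = y" using c xy by metis
  qed
  define g where "g = inv_into (carrier V) f"
  have gf [simp]: "g (f x) = x" if "x \<in> carrier V" for x
    using inj that by (simp add: g_def)
  define V' :: "(nat \<Rightarrow> complex) hilbert" where
    "V' = \<lparr> carrier = f ` carrier V, monoid.mult = undefined, one = undefined,
        zero = f \<zero>\<^bsub>V\<^esub>, add = (\<lambda>x y. f (g x \<oplus>\<^bsub>V\<^esub> g y)),
        module.smult = (\<lambda>a x. f (a \<odot>\<^bsub>V\<^esub> g x)), cinner = (\<lambda>x y. cinner V (g x) (g y)) \<rparr>"
  have sel [simp]: "carrier V' = f ` carrier V" "\<zero>\<^bsub>V'\<^esub> = f \<zero>\<^bsub>V\<^esub>"
    "x \<oplus>\<^bsub>V'\<^esub> y = f (g x \<oplus>\<^bsub>V\<^esub> g y)" "a \<odot>\<^bsub>V'\<^esub> x = f (a \<odot>\<^bsub>V\<^esub> g x)"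
    "cinner V' x y = cinner V (g x) (g y)" for x y a
    by (simp_all add: V'_def)
  have ag: "abelian_group V'"
  proof (rule abelian_groupI)
    fix x assume "x \<in> carrier V'"
    then obtain u where "u \<in> carrier V" "x = f u" by auto
    then show "\<exists>y\<in>carrier V'. y \<oplus>\<^bsub>V'\<^esub> x = \<zero>\<^bsub>V'\<^esub>"
      by (intro bexI[of _ "f (\<ominus>\<^bsub>V\<^esub> u)"]) (auto simp: V.M.l_neg)
  qed (auto simp: V.M.a_ac)
  have rc: "carrier complex_ring = UNIV" "a \<oplus>\<^bsub>complex_ring\<^esub> b = a + b"
    "a \<otimes>\<^bsub>complex_ring\<^esub> b = a * b" "\<one>\<^bsub>complex_ring\<^esub> = 1" for a b
    by (auto simp: ring_of_type_algebra_def)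
  have md: "module complex_ring V'"
  proof (rule moduleI)
    show "cring complex_ring" by (rule V.R.is_cring)
    show "abelian_group V'" by (rule ag)
  qed (use smc V.smult_l_distr V.smult_r_distr V.smult_assoc1 V.smult_one in \<open>auto simp: rc\<close>)
  interpret V': module complex_ring V' by (rule md)
  have fs: "(\<Oplus>\<^bsub>V'\<^esub>b\<in>f ` A. d (g b) \<odot>\<^bsub>V'\<^esub> b) = f (\<Oplus>\<^bsub>V\<^esub>b\<in>A. d b \<odot>\<^bsub>V\<^esub> b)"
    if "finite A" "A \<subseteq> carrier V" for A d
    using that
  proof (induction A)
    case empty
    show ?case by simp
  next
    case (insert b A)
    have nin: "f b \<notin> f ` A" using insert inj by (auto dest: inj_onD)
    have cl: "(\<lambda>b. d b \<odot>\<^bsub>V\<^esub> b) \<in> A \<rightarrow> carrier V" using insert smc by auto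
    have cl': "(\<lambda>b. d (g b) \<odot>\<^bsub>V'\<^esub> b) \<in> f ` A \<rightarrow> carrier V'"
      using insert smc by (auto simp: subset_iff)
    have b: "b \<in> carrier V" using insert by simp
    have "(\<Oplus>\<^bsub>V'\<^esub>b\<in>f ` insert b A. d (g b) \<odot>\<^bsub>V'\<^esub> b)
        = (\<Oplus>\<^bsub>V'\<^esub>b\<in>insert (f b) (f ` A). d (g b) \<odot>\<^bsub>V'\<^esub> b)"
      by simp
    also have "\<dots> = (d (g (f b)) \<odot>\<^bsub>V'\<^esub> f b) \<oplus>\<^bsub>V'\<^esub> (\<Oplus>\<^bsub>V'\<^esub>b\<in>f ` A. d (g b) \<odot>\<^bsub>V'\<^esub> b)"
      using insert(1) nin cl' b smc
      by (intro V'.M.finsum_insert) (auto simp del: sel(4), simp add: smc)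
    also have "\<dots> = f (d b \<odot>\<^bsub>V\<^esub> b \<oplus>\<^bsub>V\<^esub> (\<Oplus>\<^bsub>V\<^esub>b\<in>A. d b \<odot>\<^bsub>V\<^esub> b))"
      using insert.IH insert.prems b smc V.M.finsum_closed[OF cl] by simp
    also have "\<dots> = f (\<Oplus>\<^bsub>V\<^esub>b\<in>insert b A. d b \<odot>\<^bsub>V\<^esub> b)"
      using insert(1,2) cl b smc by simp
    finally show ?case .
  qed
  have "fd_hilbert V'"
  proof (intro fd_hilbert.intro md fd_hilbert_axioms.intro)
    show "\<exists>B. finite B \<and> B \<subseteq> carrier V' \<and>
        (\<forall>x\<in>carrier V'. \<exists>c. x = (\<Oplus>\<^bsub>V'\<^esub>b\<in>B. c b \<odot>\<^bsub>V'\<^esub> b))"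
    proof (intro exI[of _ "f ` B"] conjI ballI)
      fix x assume "x \<in> carrier V'"
      then obtain u where u: "u \<in> carrier V" "x = f u" by auto
      then have "x = (\<Oplus>\<^bsub>V'\<^esub>b\<in>f ` B. c u (g b) \<odot>\<^bsub>V'\<^esub> b)"
        using fs[OF B, of "c u"] c[OF u(1)] by simp
      then show "\<exists>c. x = (\<Oplus>\<^bsub>V'\<^esub>b\<in>f ` B. c b \<odot>\<^bsub>V'\<^esub> b)"
        by (intro exI[of _ "\<lambda>b. c u (g b)"])
    qed (use B in auto)
  next
    fix x y assume "x \<in> carrier V'" "y \<in> carrier V'"
    then show "cinner V' x y = cnj (cinner V' y x)"
      by (simp only: sel) (rule V.cinner_commute; auto)
  next
    fix x assume "x \<in> carrier V'" "cinner V' x x = 0"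
    then show "x = \<zero>\<^bsub>V'\<^esub>" using V.cinner_definite by auto
  qed (use smc V.cinner_add_right V.cinner_smult_right V.cinner_nonneg in auto)
  moreover have "linear_map V V' f" by (auto simp: linear_map_def)
  moreover have "bij_betw f (carrier V) (carrier V')" using inj by (simp add: bij_betw_def)
  ultimately show ?thesis by (rule that)
qed

lemma tensor_product_universal:
  fixes V :: "'v hilbert"
  assumes H: "fd_hilbert H" and T: "tensor_product H1 H2 H T"
    and V: "fd_hilbert V" and \<beta>: "bilinear_map H1 H2 V \<beta>"
  shows "\<exists>!L. L \<in> lin_maps H V \<and> (\<forall>x\<in>carrier H1. \<forall>y\<in>carrier H2. \<beta> x y = L (T x y))"
proof -
  interpret V: fd_hilbert V by fact
  interpret H: fd_hilbert H by fact
  obtain V' :: "(nat \<Rightarrow> complex) hilbert" and f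
    where V': "fd_hilbert V'" and lf: "linear_map V V' f"
      and bij: "bij_betw f (carrier V) (carrier V')"
    using fd_hilbert_copy[OF V] .
  interpret V': fd_hilbert V' by fact
  define g where "g = inv_into (carrier V) f"
  have fg: "f (g z) = z" "g z \<in> carrier V" if "z \<in> carrier V'" for z
    using that bij by (auto simp: g_def bij_betw_def f_inv_into_f inv_into_into)
  have gf: "g (f x) = x" "f x \<in> carrier V'" if "x \<in> carrier V" for x
    using that bij by (auto simp: g_def bij_betw_def)
  have smV: "a \<odot>\<^bsub>V\<^esub> x \<in> carrier V" if "x \<in> carrier V" for a x
    using that by (intro V.smult_closed) (auto simp: ring_of_type_algebra_def)
  have smH: "a \<odot>\<^bsub>H\<^esub> x \<in> carrier H" if "x \<in> carrier H" for a x
    using that by (intro H.smult_closed) (auto simp: ring_of_type_algebra_def)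
  have fadd: "f (x \<oplus>\<^bsub>V\<^esub> y) = f x \<oplus>\<^bsub>V'\<^esub> f y" if "x \<in> carrier V" "y \<in> carrier V" for x y
    using lf that by (auto simp: linear_map_def)
  have fsm: "f (a \<odot>\<^bsub>V\<^esub> x) = a \<odot>\<^bsub>V'\<^esub> f x" if "x \<in> carrier V" for a x
    using lf that by (auto simp: linear_map_def)
  have gadd: "g (x \<oplus>\<^bsub>V'\<^esub> y) = g x \<oplus>\<^bsub>V\<^esub> g y" if "x \<in> carrier V'" "y \<in> carrier V'" for x y
    using fadd[of "g x" "g y"] gf(1)[of "g x \<oplus>\<^bsub>V\<^esub> g y"] that fg by simp
  have gsm: "g (a \<odot>\<^bsub>V'\<^esub> x) = a \<odot>\<^bsub>V\<^esub> g x" if "x \<in> carrier V'" for a x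
    using fsm[of "g x" a] gf(1)[of "a \<odot>\<^bsub>V\<^esub> g x"] that fg smV by simp
  have Tc: "T x y \<in> carrier H" if "x \<in> carrier H1" "y \<in> carrier H2" for x y
    using T that by (auto simp: tensor_product_def bilinear_map_def linear_map_def Pi_def)
  have \<beta>c: "\<beta> x y \<in> carrier V" if "x \<in> carrier H1" "y \<in> carrier H2" for x y
    using \<beta> that by (auto simp: bilinear_map_def linear_map_def Pi_def)
  have "bilinear_map H1 H2 V' (\<lambda>x y. f (\<beta> x y))"
    using \<beta> gf(2) fadd fsm
    unfolding bilinear_map_def linear_map_def by (simp add: Pi_iff)
  then have ex1: "\<exists>!L. L \<in> lin_maps H V' \<and>
      (\<forall>x\<in>carrier H1. \<forall>y\<in>carrier H2. f (\<beta> x y) = L (T x y))"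
    using T V' unfolding tensor_product_def by blast
  then obtain L where L: "L \<in> lin_maps H V'"
    "\<And>x y. x \<in> carrier H1 \<Longrightarrow> y \<in> carrier H2 \<Longrightarrow> f (\<beta> x y) = L (T x y)"
    by blast
  have Lc: "L x \<in> carrier V'" if "x \<in> carrier H" for x
    using L(1) that by (auto simp: lin_maps_def linear_map_def)
  show ?thesis
  proof (rule ex1I[of _ "compose (carrier H) g L"], intro conjI ballI)
    show "compose (carrier H) g L \<in> lin_maps H V"
      using L(1) Lc fg(2) gadd gsm smH
      by (auto simp: lin_maps_def linear_map_def compose_def)
    show "\<beta> x y = compose (carrier H) g L (T x y)"
      if "x \<in> carrier H1" "y \<in> carrier H2" for x y
      using L(2)[OF that] gf(1)[OF \<beta>c[OF that]] Tc[OF that] by (simp add: compose_def)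
  next
    fix M assume M: "M \<in> lin_maps H V \<and>
      (\<forall>x\<in>carrier H1. \<forall>y\<in>carrier H2. \<beta> x y = M (T x y))"
    have Mc: "M x \<in> carrier V" if "x \<in> carrier H" for x
      using M that by (auto simp: lin_maps_def linear_map_def)
    have "compose (carrier H) f M \<in> lin_maps H V'"
      using M Mc gf(2) fadd fsm smH
      by (auto simp: lin_maps_def linear_map_def compose_def)
    moreover have "\<forall>x\<in>carrier H1. \<forall>y\<in>carrier H2. f (\<beta> x y) = compose (carrier H) f M (T x y)"
      using M Tc by (simp add: compose_def)
    ultimately have eq: "L = compose (carrier H) f M" using ex1 L by blast
    show "M = compose (carrier H) g L"
      by (rule extensionalityI[of _ "carrier H"])
        (use M Mc gf(1) in \<open>auto simp: eq compose_def lin_maps_def\<close>)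
  qed
qed

lemma tensor_op_spec:
  assumes "fd_hilbert H" and T: "tensor_product H1 H2 H T"
    and L: "L1 \<in> lin_ops H1" "L2 \<in> lin_ops H2"
  shows "tensor_op H1 H2 H T L1 L2 \<in> lin_ops H \<and>
    (\<forall>x\<in>carrier H1. \<forall>y\<in>carrier H2. tensor_op H1 H2 H T L1 L2 (T x y) = T (L1 x) (L2 y))"
proof -
  have "bilinear_map H1 H2 H (\<lambda>x y. T (L1 x) (L2 y))"
    using T L by (simp add: tensor_product_def bilinear_map_def lin_maps_def linear_map_def Pi_iff)
  from tensor_product_universal[OF assms(1) T assms(1) this]
  have "\<exists>!M. M \<in> lin_ops H \<and>
      (\<forall>x\<in>carrier H1. \<forall>y\<in>carrier H2. M (T x y) = T (L1 x) (L2 y))"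
    by (simp add: eq_commute)
  then show ?thesis unfolding tensor_op_def by (rule theI')
qed

end

theory Submission
  imports Defs
begin

text \<open>By maximal generality, a linear operator on \<open>H\<close> is determined by its values
  on product vectors, so being a tensor product of \<open>L1\<close> and \<open>L2\<close> can be
  tested on such vectors alone (\<open>eq_tensor_op_iff\<close>). On a product vector, the condition
  for the conjugated operator reads \<open>adj H W (L (W (T x y))) = T (L1 x) (L2 y)\<close>.
  Applying the bijection \<open>W\<close> turns it into
  \<open>L (T' x y) = T' (L1 x) (L2 y)\<close>, which is the same test for \<open>L\<close> and
  \<open>T'\<close>. The second claim is only the cancellation of \<open>adj H W\<close> against
  \<open>W\<close> (\<open>unitary_op_adj\<close>).\<close>

lemma lin_ops_closed: "\<lbrakk>A \<in> lin_ops H; x \<in> carrier H\<rbrakk> \<Longrightarrow> A x \<in> carrier H"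
  by (auto simp: lin_maps_def linear_map_def)

lemma compose_lin_ops:
  assumes "fd_hilbert H" "A \<in> lin_ops H" "B \<in> lin_ops H"
  shows "compose (carrier H) A B \<in> lin_ops H"
proof -
  interpret fd_hilbert H by fact
  have "a \<odot>\<^bsub>H\<^esub> x \<in> carrier H" if "x \<in> carrier H" for a x
    using that by (intro smult_closed) (auto simp: ring_of_type_algebra_def)
  then show ?thesis
    using assms(2,3) by (auto simp: lin_maps_def linear_map_def compose_def Pi_iff)
qed

text \<open>Unitarity supplies some adjoint that is a two-sided inverse; uniqueness of adjoints
  (\<open>adj_eqI\<close>) identifies it with \<open>adj H W\<close>. The inverse laws are stated
  pointwise so that they can serve as rewrite rules.\<close>

lemma unitary_op_adj:
  assumes H: "fd_hilbert H" and W: "unitary_op H W"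
  shows "W \<in> lin_ops H" and "adj H W \<in> lin_ops H"
    and "x \<in> carrier H \<Longrightarrow> adj H W (W x) = x"
    and "x \<in> carrier H \<Longrightarrow> W (adj H W x) = x"
proof -
  obtain B where B: "is_adjoint H W B" "compose (carrier H) B W = id_op H"
      "compose (carrier H) W B = id_op H"
    using W by (auto simp: unitary_op_def)
  have adj: "adj H W = B"
    using adj_eqI[OF H B(1)] .
  show "W \<in> lin_ops H" "adj H W \<in> lin_ops H"
    using W B(1) adj by (auto simp: unitary_op_def is_adjoint_def)
  show "adj H W (W x) = x" "W (adj H W x) = x" if "x \<in> carrier H"
    using fun_cong[OF B(2), of x] fun_cong[OF B(3), of x] that adj
    by (simp_all add: compose_def id_op_def)
qed

text \<open>Replaces an equation with an operator given by a definite description by a condition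
  that can be checked on product vectors.\<close>

lemma eq_tensor_op_iff:
  assumes H: "fd_hilbert H" and T: "tensor_product H1 H2 H T"
    and L: "L1 \<in> lin_ops H1" "L2 \<in> lin_ops H2" and M: "M \<in> lin_ops H"
  shows "M = tensor_op H1 H2 H T L1 L2 \<longleftrightarrow>
    (\<forall>x\<in>carrier H1. \<forall>y\<in>carrier H2. M (T x y) = T (L1 x) (L2 y))"
proof -
  note spec = tensor_op_spec[OF H T L]
  have "bilinear_map H1 H2 H (\<lambda>x y. T (L1 x) (L2 y))"
    using T L by (simp add: tensor_product_def bilinear_map_def lin_maps_def linear_map_def Pi_iff)
  \<comment> \<open>If \<open>M\<close> passes the test, then \<open>M\<close> and
    \<open>tensor_op H1 H2 H T L1 L2\<close> both factor this bilinear map through \<open>T\<close>,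
    so the uniqueness part makes them equal. The converse is \<open>spec\<close>.\<close>
  from tensor_product_universal[OF H T H this] spec M show ?thesis
    by metis
qed

theorem corollary3p1:
  fixes H1 :: "'a hilbert" and H2 :: "'b hilbert" and H :: "'c hilbert"
    and T T' :: "'a \<Rightarrow> 'b \<Rightarrow> 'c"
    and W L :: "'c \<Rightarrow> 'c" and L1 :: "'a \<Rightarrow> 'a" and L2 :: "'b \<Rightarrow> 'b"
  assumes "fd_hilbert H1" and "fd_hilbert H2" and "fd_hilbert H"
    and "tensor_product H1 H2 H T" and "tensor_product H1 H2 H T'"
    and "unitary_op H W"
    and "\<forall>x\<in>carrier H1. \<forall>y\<in>carrier H2. T' x y = W (T x y)"
    and "L \<in> lin_ops H" and "L1 \<in> lin_ops H1" and "L2 \<in> lin_ops H2"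
  shows "(compose (carrier H) (adj H W) (compose (carrier H) L W) = tensor_op H1 H2 H T L1 L2
            \<longleftrightarrow> L = tensor_op H1 H2 H T' L1 L2)
       \<and> (\<forall>x\<in>carrier H.
            compose (carrier H) W (compose (carrier H) L (adj H W)) (W x) = W (L x))"
proof (intro conjI ballI)
  note H = assms(3) and T = assms(4) and T' = assms(5) and WT = assms(7)
    and L = assms(8) and L12 = assms(9,10)
  note W = unitary_op_adj[OF H assms(6)]
  note closed = lin_ops_closed[OF W(1)] lin_ops_closed[OF W(2)] lin_ops_closed[OF L]
    lin_ops_closed[OF L12(1)] lin_ops_closed[OF L12(2)]
  have Tc: "T x y \<in> carrier H" if "x \<in> carrier H1" "y \<in> carrier H2" for x y
    using T that by (auto simp: tensor_product_def bilinear_map_def linear_map_def Pi_def)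
  \<comment> \<open>Moves the adjoint to the other side as \<open>W\<close>; each direction uses one
    of the two inverse laws.\<close>
  have swap: "adj H W u = v \<longleftrightarrow> u = W v" if "u \<in> carrier H" "v \<in> carrier H" for u v
    using W(3)[OF that(2)] W(4)[OF that(1)] by auto
  let ?M = "compose (carrier H) (adj H W) (compose (carrier H) L W)"
  have "?M = tensor_op H1 H2 H T L1 L2 \<longleftrightarrow>
      (\<forall>x\<in>carrier H1. \<forall>y\<in>carrier H2. ?M (T x y) = T (L1 x) (L2 y))"
    using H W L by (intro eq_tensor_op_iff[OF H T L12] compose_lin_ops)
  also have "\<dots> \<longleftrightarrow> (\<forall>x\<in>carrier H1. \<forall>y\<in>carrier H2. L (T' x y) = T' (L1 x) (L2 y))"
    \<comment> \<open>After \<open>swap\<close>, \<open>W\<close> stands in front of a product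
      vector on both sides, and \<open>WT\<close> reads each as a value of
      \<open>T'\<close>.\<close>
    by (intro ball_cong refl) (simp add: compose_def Tc WT closed swap)
  also have "\<dots> \<longleftrightarrow> L = tensor_op H1 H2 H T' L1 L2"
    by (rule eq_tensor_op_iff[OF H T' L12 L, symmetric])
  finally show "?M = tensor_op H1 H2 H T L1 L2 \<longleftrightarrow> L = tensor_op H1 H2 H T' L1 L2" .
  show "compose (carrier H) W (compose (carrier H) L (adj H W)) (W x) = W (L x)"
    if "x \<in> carrier H" for x
    using that by (simp add: compose_def W(3) closed)
qed

end
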